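(* Let $q$ be a prime number and let $\omega_q = w_0w_1w_2\cdots$ be the generalized Thue-Morse word over $\Sigma_q=\{0,1,\dots,q-1\}$, i.e. $w_i = s_q(i)$, the sum modulo $q$ of the digits of the base-$q$ expansion of $i$. For every integer $n\geq 1$, \[ \max_{1\le d<q^n} L_{\omega_q}(d) = \begin{cases} q^n+2q, & n\equiv 0 \pmod q,\\ q^n, & \text{otherwise.}\end{cases} \] Moreover, in both cases the maximum is attained at the difference $d=q^n-1$.
   Context: For an infinite word $\omega=w_0w_1w_2\cdots$ and integers $c\ge 0$, $d\ge 1$, $L_\omega(c,d)$ denotes the length of the arithmetic progression with initial number $c$ and difference $d$ in $\omega$, i.e. the largest $k\ge 1$ such that $w_c=w_{c+d}=\cdots=w_{c+(k-1)d}$ (or $\infty$ if no such largest $k$ exists). Further $L_\omega(d)=\max_{c\ge 0} L_\omega(c,d)$ is the length of the longest arithmetic progression (constant arithmetic subsequence) with difference $d$ in $\omega$. *)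

theory Defs
  imports Complex_Main "HOL-Library.Extended_Nat" "HOL-Computational_Algebra.Primes"
begin

function digit_sum :: "nat \<Rightarrow> nat \<Rightarrow> nat" where
  "digit_sum b i = (if b < 2 \<or> i = 0 then 0 else i mod b + digit_sum b (i div b))"
  by pat_completeness auto
termination
  by (relation "measure snd") auto

declare digit_sum.simps [simp del]

definition thue_morse :: "nat \<Rightarrow> nat \<Rightarrow> nat" where
  "thue_morse q i = digit_sum q i mod q"

(* Both suprema range over nonempty sets of extended naturals. Such a supremum is the
   maximum if the set is bounded, and \<infinity> exactly if it is unbounded or contains \<infinity>. *)

definition ap_length_at :: "(nat \<Rightarrow> 'a) \<Rightarrow> nat \<Rightarrow> nat \<Rightarrow> enat" where
  "ap_length_at w c d = Sup {enat k | k. 1 \<le> k \<and> (\<forall>j<k. w (c + j * d) = w c)}"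

definition ap_length :: "(nat \<Rightarrow> 'a) \<Rightarrow> nat \<Rightarrow> enat" where
  "ap_length w d = (SUP c. ap_length_at w c d)"

end

theory Submission
  imports Defs "HOL-Number_Theory.Cong"
begin

text \<open>Write \<open>s\<close> for the digit sum modulo \<open>q\<close>, so that \<open>s(u q^n + v) = s(u) + s(v)\<close> for \<open>v < q^n\<close>.
  A difference divisible by \<open>q\<close> may be divided by \<open>q\<close>. If \<open>q\<close> does not divide \<open>d\<close>, then among
  \<open>q^n\<close> consecutive terms of the progression every residue \<open>v\<close> modulo \<open>q^n\<close> occurs, so a longer
  constant progression gives \<open>s(v + d) = s(v)\<close> whenever \<open>v + d < q^n\<close>. Put \<open>e = q^n - d\<close>.
  For \<open>e > q\<close> the residues \<open>v = e - q - 1\<close> and \<open>v = e - q\<close> are incompatible, because \<open>s\<close> grows by 1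
  from the first to the second, but by 2 from \<open>q^n - q - 1\<close> to \<open>q^n - q\<close>. For \<open>1 < e < q\<close>, two
  consecutive steps from a residue \<open>v = e + q a\<close> raise the high part \<open>u\<close> twice, and in neither does
  \<open>s(u)\<close> grow by 1; but one of the two steps has no carry. Hence \<open>d = q^n - 1\<close>. Then \<open>v = 0\<close>
  yields \<open>s(q^n - 1) = 0\<close>, that is \<open>q dvd n\<close>; and the steps from \<open>v = q\<close> and, \<open>2 q\<close> terms later,
  from \<open>v = q^n - q\<close> force \<open>q\<close> to divide two numbers that differ by \<open>2 q - 1\<close>.

  For the lower bounds, \<open>k (q^n - 1)\<close> with \<open>1 \<le> k \<le> q^n\<close> has digit sum \<open>n (q - 1)\<close>. If \<open>q dvd n\<close>,
  shifting this progression by \<open>q^(q+n) q^n\<close> allows \<open>q\<close> further terms at each end.\<close>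

section \<open>Digit sums\<close>

lemma digit_sum_mult_add:
  assumes "r < q" "2 \<le> q"
  shows "digit_sum q (a * q + r) = digit_sum q a + r"
proof (cases "a * q + r = 0")
  case True
  with assms show ?thesis by (simp add: digit_sum.simps)
next
  case False
  have "(a * q + r) mod q = r" "(a * q + r) div q = a"
    using assms by auto
  with False assms show ?thesis
    by (subst digit_sum.simps) auto
qed

lemma digit_sum_0 [simp]: "digit_sum q 0 = 0"
  by (simp add: digit_sum.simps)

lemma digit_sum_less:
  assumes "r < q"
  shows "digit_sum q r = r"
proof (cases "2 \<le> q")
  case True
  then show ?thesis using digit_sum_mult_add[of r q 0] assms by simp
next
  case False
  with assms have "r = 0" by simp
  then show ?thesis by simp
qed

lemma digit_sum_mult:
  assumes "2 \<le> q"
  shows "digit_sum q (q * a) = digit_sum q a"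
  using digit_sum_mult_add[of 0 q a] assms by (simp add: mult.commute)

lemma digit_sum_power_mult_add:
  assumes "2 \<le> q" "v < q ^ n"
  shows "digit_sum q (u * q ^ n + v) = digit_sum q u + digit_sum q v"
  using assms(2)
proof (induction n arbitrary: v)
  case 0
  then show ?case by simp
next
  case (Suc n)
  define a r where "a = v div q" and "r = v mod q"
  have v: "v = a * q + r" and r: "r < q"
    using assms(1) by (auto simp: a_def r_def)
  have "a < q ^ n"
    unfolding a_def using Suc.prems assms(1) by (simp add: div_less_iff_less_mult mult.commute)
  moreover have "u * q ^ Suc n + v = (u * q ^ n + a) * q + r"
    by (simp add: v algebra_simps)
  ultimately show ?case
    using Suc.IH digit_sum_mult_add[OF r assms(1)] by (simp only: v)
qed

lemma digit_sum_Suc: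
  assumes "2 \<le> q" "\<not> q dvd Suc m"
  shows "digit_sum q (Suc m) = Suc (digit_sum q m)"
proof -
  define a r where "a = m div q" and "r = m mod q"
  have m: "m = a * q + r" and r: "r < q"
    using assms(1) by (auto simp: a_def r_def)
  have "Suc r \<noteq> q"
  proof
    assume "Suc r = q"
    then have "Suc m = Suc a * q" by (simp add: m)
    with assms(2) show False by (metis dvd_triv_right)
  qed
  with r have "Suc r < q" by simp
  from digit_sum_mult_add[OF this assms(1), of a] digit_sum_mult_add[OF r assms(1), of a]
  show ?thesis by (simp add: m)
qed

text \<open>All \<open>n\<close> digits of \<open>q ^ n - 1\<close> equal \<open>q - 1\<close>, so
  subtracting \<open>v\<close> never borrows: each digit \<open>r\<close> of \<open>v\<close>,
  leading zeros included, becomes \<open>q - 1 - r\<close>.\<close>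

lemma digit_sum_complement:
  assumes "2 \<le> q" "v < q ^ n"
  shows "digit_sum q (q ^ n - 1 - v) + digit_sum q v = n * (q - 1)"
  using assms(2)
proof (induction n arbitrary: v)
  case 0
  then show ?case by simp
next
  case (Suc n)
  define a r where "a = v div q" and "r = v mod q"
  have v: "v = a * q + r" and r: "r < q"
    using assms(1) by (auto simp: a_def r_def)
  have a: "a < q ^ n"
    unfolding a_def using Suc.prems assms(1) by (simp add: div_less_iff_less_mult mult.commute)
  then obtain b where b: "q ^ n = Suc (a + b)"
    using less_iff_Suc_add by auto
  obtain t where t: "q = Suc (r + t)"
    using r less_iff_Suc_add by auto
  have "q ^ Suc n = q * Suc (a + b)"
    using b by simp
  also have "\<dots> = b * q + t + v + 1"
    by (simp add: v algebra_simps) (simp add: t)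
  finally have "q ^ Suc n - 1 - v = b * q + t" by simp
  moreover have "t < q" using t by simp
  moreover have "digit_sum q b + digit_sum q a = n * (q - 1)"
    using Suc.IH[OF a] b by simp
  ultimately show ?case
    using digit_sum_mult_add[OF r assms(1)] digit_sum_mult_add[OF _ assms(1), of t b] v t by simp
qed

lemma digit_sum_power_minus_Suc_0:
  assumes "2 \<le> q"
  shows "digit_sum q (q ^ n - 1) = n * (q - 1)"
  using digit_sum_complement[OF assms, of 0 n] assms by simp

text \<open>The two numbers are the complements of \<open>q - 1\<close> and \<open>q\<close>, whose
  digit sums are \<open>q - 1\<close> and 1. Because of the carry the digit sum grows by 2 modulo
  \<open>q\<close>.\<close>

lemma digit_sum_power_minus_base:
  assumes "2 \<le> q" "2 \<le> n"
  shows "digit_sum q (q ^ n - q) + q = digit_sum q (q ^ n - q - 1) + 2"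
proof -
  have "q ^ 1 < q ^ n"
    using assms by (intro power_strict_increasing) auto
  then have lt: "q < q ^ n" by simp
  have "digit_sum q (q ^ n - 1 - (q - 1)) + (q - 1) = n * (q - 1)"
    using digit_sum_complement[OF assms(1), of "q - 1" n] lt assms(1) by (simp add: digit_sum_less)
  moreover have "digit_sum q q = 1"
    using digit_sum_mult[OF assms(1), of 1] assms(1) by (simp add: digit_sum_less)
  then have "digit_sum q (q ^ n - 1 - q) + 1 = n * (q - 1)"
    using digit_sum_complement[OF assms(1) lt] by simp
  moreover have "q ^ n - 1 - (q - 1) = q ^ n - q" "q ^ n - 1 - q = q ^ n - q - 1"
    using assms(1) by auto
  ultimately show ?thesis
    using assms(1) by simp
qed

lemma thue_morse_eq_iff:
  "thue_morse q a = thue_morse q b \<longleftrightarrow> int q dvd int (digit_sum q a) - int (digit_sum q b)"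
  unfolding thue_morse_def by (metis mod_eq_dvd_iff of_nat_eq_iff zmod_int)

lemma not_dvd_between:
  fixes x :: int
  assumes "0 < x" "x < int q"
  shows "\<not> int q dvd x"
  using assms zdvd_not_zless by blast

section \<open>Upper bound\<close>

lemma progression_hits_residue:
  fixes c d m v :: nat
  assumes "coprime d m" "v < m"
  shows "\<exists>j<m. \<exists>u. c + j * d = u * m + v"
proof -
  have m: "0 < m" using assms by simp
  obtain i where i: "[d * i = 1] (mod m)"
    using cong_solve_coprime_nat[OF assms(1)] by auto
  \<comment> \<open>As \<open>i\<close> inverts \<open>d\<close>, this is \<open>(v - c) / d\<close>
    modulo \<open>m\<close>; \<open>m - c mod m\<close> stands for \<open>- c\<close>.\<close>
  define j where "j = (i * (v + (m - c mod m))) mod m"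
  have "[j = i * (v + (m - c mod m))] (mod m)"
    by (simp add: j_def cong_def)
  then have "[c + d * j = c + d * (i * (v + (m - c mod m)))] (mod m)"
    by (intro cong_add cong_mult cong_refl)
  then have "[c + j * d = c + (d * i) * (v + (m - c mod m))] (mod m)"
    by (simp only: mult.assoc mult.commute[of j])
  also have "[c + (d * i) * (v + (m - c mod m)) = c mod m + 1 * (v + (m - c mod m))] (mod m)"
    by (intro cong_add cong_mult i cong_refl) (simp add: cong_def)
  also have "c mod m + 1 * (v + (m - c mod m)) = v + m"
    using mod_less_divisor[OF m, of c] by simp
  finally have "(c + j * d) mod m = v"
    using assms(2) by (simp add: cong_def)
  then have "c + j * d = (c + j * d) div m * m + v"
    by (metis div_mult_mod_eq)
  moreover have "j < m" using m by (simp add: j_def)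
  ultimately show ?thesis by blast
qed

lemma progression_difference:
  assumes q: "prime q" and n: "1 \<le> n" and d: "d < q ^ n" "\<not> q dvd d"
    and k: "q ^ n < k" and ap: "\<And>j. j < k \<Longrightarrow> thue_morse q (c + j * d) = thue_morse q c"
  shows "d = q ^ n - 1"
proof -
  have q2: "2 \<le> q" using q by (rule prime_ge_2_nat)
  define e where "e = q ^ n - d"
  have de: "d + e = q ^ n" and e0: "0 < e" using d by (auto simp: e_def)
  have "coprime d (q ^ n)"
    using prime_imp_coprime[OF q d(2)] by (simp add: coprime_commute)
  note hit = progression_hits_residue[OF this]
  have no_carry: "int q dvd int (digit_sum q (v + d)) - int (digit_sum q v)" if "v + d < q ^ n" for v
  proof -
    have v: "v < q ^ n" using that by simp
    from hit[OF this, of c] obtain j u where j: "j < q ^ n" and x: "c + j * d = u * q ^ n + v" by blast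
    have "thue_morse q (c + Suc j * d) = thue_morse q (c + j * d)"
      using ap[of j] ap[of "Suc j"] j k by simp
    moreover have "c + Suc j * d = u * q ^ n + (v + d)" using x by simp
    ultimately show ?thesis
      unfolding thue_morse_eq_iff
      by (simp only: x digit_sum_power_mult_add[OF q2 v] digit_sum_power_mult_add[OF q2 that]) simp
  qed
  have "q dvd q ^ n" using n by (simp add: dvd_power)
  then have qe: "\<not> q dvd e" using d(2) de by (metis dvd_add_left_iff)
  have "e < q"
  proof (rule ccontr)
    assume "\<not> e < q"
    with qe have e: "q < e" by (cases "e = q") auto
    have n2: "2 \<le> n"
    proof (rule ccontr)
      assume "\<not> 2 \<le> n"
      with n have "n = 1" by simp
      with e de show False by simp
    qed
    obtain v where v: "e = q + Suc v" using e less_iff_Suc_add by auto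
    have "\<not> q dvd Suc v" using qe unfolding v by (metis dvd_add dvd_refl)
    then have "digit_sum q (Suc v) = Suc (digit_sum q v)" by (rule digit_sum_Suc[OF q2])
    moreover have "v + d = q ^ n - q - 1" "Suc v + d = q ^ n - q" "v + d < q ^ n" "Suc v + d < q ^ n"
      using v de q2 by auto
    ultimately have "int q dvd int (digit_sum q (q ^ n - q - 1)) - int (digit_sum q v)"
      "int q dvd int (digit_sum q (q ^ n - q)) - int (digit_sum q v) - 1"
      using no_carry[of v] no_carry[of "Suc v"] by (simp_all add: algebra_simps)
    \<comment> \<open>The difference of the two multiples is \<open>1 - q\<close>; adding
      \<open>q\<close> leaves exactly 1.\<close>
    from dvd_add[OF dvd_diff[OF this(2,1)] dvd_refl]
    have "int q dvd (int (digit_sum q (q ^ n - q)) - int (digit_sum q v) - 1)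
       - (int (digit_sum q (q ^ n - q - 1)) - int (digit_sum q v)) + int q" .
    also have "\<dots> = 1"
      using digit_sum_power_minus_base[OF q2 n2] by linarith
    finally show False using q2 by simp
  qed
  have "e = 1"
  proof (rule ccontr)
    assume "e \<noteq> 1"
    with e0 have e2: "2 \<le> e" by simp
    with \<open>e < q\<close> have q3: "3 \<le> q" by simp
    have n2: "2 \<le> n"
    proof (rule ccontr)
      assume "\<not> 2 \<le> n"
      with n have "n = 1" by simp
      with d(1) have "d < q" by simp
      with no_carry[of 0] d have "int q dvd int d" by (simp add: digit_sum_less)
      with d(2) show False by simp
    qed
    have "3 * q \<le> q * q" using q3 by simp
    also have "q * q = q ^ 2" by (simp add: power2_eq_square)
    also have "\<dots> \<le> q ^ n" using n2 q2 by (intro power_increasing) auto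
    finally have big: "3 * q \<le> q ^ n" .
    obtain j1 u1 where j1: "j1 < q ^ n" "c + j1 * d = u1 * q ^ n + (e + q * 1)"
      using hit[of "e + q * 1" c] big \<open>e < q\<close> by auto
    obtain j2 u2 where j2: "j2 < q ^ n" "c + j2 * d = u2 * q ^ n + (e + q * 2)"
      using hit[of "e + q * 2" c] big \<open>e < q\<close> by auto
    have "j1 \<noteq> j2"
    proof
      assume "j1 = j2"
      then have "(u1 * q ^ n + (e + q * 1)) mod q ^ n = (u2 * q ^ n + (e + q * 2)) mod q ^ n"
        by (simp only: j1(2)[symmetric] j2(2)[symmetric])
      then show False using big \<open>e < q\<close> by simp
    qed
    \<comment> \<open>Two residues are tried because two further terms of the progression must follow.\<close>
    then have "j1 + 1 < q ^ n \<or> j2 + 1 < q ^ n" using j1(1) j2(1) by linarith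
    then obtain j u a where j: "j + 1 < q ^ n" and x: "c + j * d = u * q ^ n + (e + q * a)"
      and a: "a = 1 \<or> a = 2"
      using j1(2) j2(2) by blast
    have e_lt: "e + q * a < q ^ n" using a big \<open>e < q\<close> by auto
    \<comment> \<open>Adding \<open>d = q ^ n - e\<close> raises the high part by 1 and lowers the
      low part by \<open>e\<close>. The second time this borrows from the digit \<open>a\<close>,
      which is possible as \<open>a\<close> is at least 1.\<close>
    have x1: "c + (j + 1) * d = (u + 1) * q ^ n + q * a"
      using x de by (simp add: algebra_simps)
    have "c + (j + 2) * d + e = c + (j + 1) * d + q ^ n"
      using de by (simp add: algebra_simps)
    also have "\<dots> = (u + 2) * q ^ n + ((a - 1) * q + (q - e)) + e"
      using x1 a \<open>e < q\<close> by (auto simp: algebra_simps)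
    finally have x2: "c + (j + 2) * d = (u + 2) * q ^ n + ((a - 1) * q + (q - e))" by simp
    have a_lt: "a < q" using a q3 by auto
    have s0: "digit_sum q (c + j * d) = digit_sum q u + (a + e)"
      unfolding x digit_sum_power_mult_add[OF q2 e_lt]
      using digit_sum_mult_add[OF \<open>e < q\<close> q2, of a] a_lt
      by (simp add: digit_sum_less add.commute mult.commute)
    have "q * a < q ^ n" using e_lt by simp
    then have s1: "digit_sum q (c + (j + 1) * d) = digit_sum q (u + 1) + a"
      using digit_sum_power_mult_add[OF q2] digit_sum_mult[OF q2, of a] a_lt
      by (simp only: x1 digit_sum_less)
    have lt: "(a - 1) * q + (q - e) < q ^ n" using a big \<open>e < q\<close> e0 by auto
    have "q - e < q" using e0 q2 by simp
    then have s2: "digit_sum q (c + (j + 2) * d) = digit_sum q (u + 2) + (a - 1 + (q - e))"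
      using digit_sum_power_mult_add[OF q2 lt] digit_sum_mult_add[OF _ q2, of "q - e" "a - 1"] a_lt
      by (simp only: x2 digit_sum_less)
    have "thue_morse q (c + (j + 1) * d) = thue_morse q (c + j * d)"
      "thue_morse q (c + (j + 2) * d) = thue_morse q (c + (j + 1) * d)"
      using ap[of j] ap[of "j + 1"] ap[of "j + 2"] j k by simp_all
    \<comment> \<open>Modulo \<open>q\<close>, the digit sum of the high part grows by
      \<open>e\<close> and then by \<open>e + 1\<close>; neither is 1, since
      \<open>1 < e < q\<close>.\<close>
    then have t1: "int q dvd int (digit_sum q (u + 1)) - int (digit_sum q u) - int e"
      and t2: "int q dvd int (digit_sum q (u + 2)) - int (digit_sum q (u + 1)) - 1 - int e + int q"
      unfolding thue_morse_eq_iff s0 s1 s2 using a \<open>e < q\<close>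
      by (auto simp: algebra_simps of_nat_diff)
    show False
    proof (cases "q dvd u + 1")
      case False
      then have "digit_sum q (u + 1) = digit_sum q u + 1"
        using digit_sum_Suc[OF q2, of u] by simp
      with t1 have "int q dvd 1 - int e" by simp
      then have "int q dvd int e - 1" by (subst dvd_diff_commute)
      then show False using not_dvd_between[of "int e - 1" q] e2 \<open>e < q\<close> by simp
    next
      case True
      have "\<not> q dvd u + 2"
      proof
        assume "q dvd u + 2"
        with True have "q dvd (u + 2) - (u + 1)" by (rule dvd_diff_nat[rotated])
        with q2 show False by simp
      qed
      then have "digit_sum q (u + 2) = digit_sum q (u + 1) + 1"
        using digit_sum_Suc[OF q2, of "u + 1"] by simp
      with t2 have "int q dvd int q - int e" by simp
      then show False using not_dvd_between[of "int q - int e" q] e0 \<open>e < q\<close> by simp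
    qed
  qed
  with de show ?thesis by simp
qed

text \<open>Each step lowers the residue by 1 and raises the high part by 1, except from residue 0:
  there the high part stays and the low part becomes \<open>q ^ n - 1\<close>.\<close>

lemma progression_maximal_difference:
  assumes q: "prime q" and n: "1 \<le> n"
    and k: "q ^ n < k" and ap: "\<And>j. j < k \<Longrightarrow> thue_morse q (c + j * (q ^ n - 1)) = thue_morse q c"
  shows "q dvd n \<and> k \<le> q ^ n + 2 * q"
proof -
  have q2: "2 \<le> q" using q by (rule prime_ge_2_nat)
  define d where "d = q ^ n - 1"
  have pos: "0 < q ^ n" using q2 by simp
  have d: "d + 1 = q ^ n" using pos by (simp add: d_def)
  have "coprime d (q ^ n)"
    using d coprime_Suc_right_nat[of d] by simp
  note hit = progression_hits_residue[OF this, of _ c]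
  have step: "int q dvd int (digit_sum q (c + Suc j * d)) - int (digit_sum q (c + j * d))"
    if "Suc j < k" for j
    using that ap[of j] ap[of "Suc j"] unfolding thue_morse_eq_iff[symmetric] d_def by simp
  have dvd: "q dvd n"
  proof -
    from hit[OF pos] obtain j u where j: "j < q ^ n" and x: "c + j * d = u * q ^ n" by auto
    have "c + Suc j * d = u * q ^ n + d" using x by simp
    then have "digit_sum q (c + Suc j * d) = digit_sum q u + n * (q - 1)"
      using digit_sum_power_mult_add[OF q2, of d n u] digit_sum_power_minus_Suc_0[OF q2, of n] d
      by (simp add: d_def)
    moreover have "digit_sum q (c + j * d) = digit_sum q u"
      using digit_sum_power_mult_add[OF q2 pos, of u] by (simp add: x)
    ultimately have "int q dvd int (n * (q - 1))"
      using step[of j] j k by simp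
    then have "q dvd n * (q - 1)" by (simp only: of_nat_dvd_iff)
    then show ?thesis
      using q q2 by (auto simp: prime_dvd_mult_iff dest: dvd_imp_le)
  qed
  have n2: "2 \<le> n" using dvd n q2 by (auto dest: dvd_imp_le)
  have "q ^ 1 < q ^ n" using n2 q2 by (intro power_strict_increasing) auto
  then have q_lt: "q < q ^ n" by simp
  have "k \<le> q ^ n + 2 * q"
  proof (rule ccontr)
    assume big: "\<not> k \<le> q ^ n + 2 * q"
    from hit[OF q_lt] obtain j u where j: "j < q ^ n" and x: "c + j * d = u * q ^ n + q" by blast
    have "c + Suc j * d = (u + 1) * q ^ n + (q - 1)" (is "_ = ?y1")
      using x d q2 by (simp add: algebra_simps)
    moreover have "digit_sum q ?y1 = digit_sum q (u + 1) + (q - 1)"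
      using digit_sum_power_mult_add[OF q2, of "q - 1" n "u + 1"] q_lt q2 by (simp add: digit_sum_less)
    moreover have "digit_sum q (u * q ^ n + q) = digit_sum q u + 1"
      using digit_sum_power_mult_add[OF q2 q_lt] digit_sum_mult[OF q2, of 1] q2
      by (simp add: digit_sum_less)
    ultimately have t1: "int q dvd int (digit_sum q (u + 1)) - int (digit_sum q u) + int q - 2"
      using step[of j] j big x q2 by (simp add: of_nat_diff algebra_simps)
    \<comment> \<open>The high part after \<open>2 * q\<close> steps: the residue falls from
      \<open>q\<close> through 0 to \<open>q ^ n - q\<close>, and the step from 0 does not raise the
      high part. One step more has index at most \<open>q ^ n + 2 * q\<close>, still below
      \<open>k\<close>.\<close>
    define w where "w = u + 2 * q - 1"
    have w: "w + 1 = u + 2 * q" using q2 by (simp add: w_def)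
    have "c + (j + 2 * q) * d + 2 * q = c + j * d + 2 * q * (d + 1)" by (simp add: algebra_simps)
    also have "\<dots> = (w + 1) * q ^ n + q"
      unfolding d w x by (simp add: algebra_simps)
    finally have x2: "c + (j + 2 * q) * d = w * q ^ n + (q ^ n - q)"
      using q_lt by simp
    then have y2: "c + Suc (j + 2 * q) * d = (w + 1) * q ^ n + (q ^ n - q - 1)"
      using d q_lt by simp
    have "digit_sum q (c + (j + 2 * q) * d) = digit_sum q w + digit_sum q (q ^ n - q)"
      unfolding x2 using q_lt q2 by (intro digit_sum_power_mult_add) auto
    moreover have "digit_sum q (c + Suc (j + 2 * q) * d) = digit_sum q (w + 1) + digit_sum q (q ^ n - q - 1)"
      unfolding y2 using q_lt q2 by (intro digit_sum_power_mult_add) auto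
    moreover have "int q dvd int (digit_sum q (c + Suc (j + 2 * q) * d)) -
        int (digit_sum q (c + (j + 2 * q) * d))"
      using step[of "j + 2 * q"] j big by simp
    moreover have "int (digit_sum q (q ^ n - q - 1)) = int (digit_sum q (q ^ n - q)) + int q - 2"
      using digit_sum_power_minus_base[OF q2 n2] by linarith
    ultimately have t2: "int q dvd int (digit_sum q (w + 1)) - int (digit_sum q w) + int q - 2"
      by (simp only: of_nat_add) (simp add: algebra_simps)
    \<comment> \<open>Both \<open>t1\<close> and \<open>t2\<close> demand growth by 2 modulo
      \<open>q\<close>, whereas without a carry the growth is 1.\<close>
    have False if nd: "\<not> q dvd Suc m"
      and t: "int q dvd int (digit_sum q (m + 1)) - int (digit_sum q m) + int q - 2" for m
    proof -
      have "int q dvd int q - 1" using t digit_sum_Suc[OF q2 nd] by simp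
      then show False using not_dvd_between[of "int q - 1" q] q2 by simp
    qed
    then have "q dvd Suc u" "q dvd Suc w" using t1 t2 by blast+
    then have "q dvd Suc u + 2 * q - Suc w" by (intro dvd_diff_nat dvd_add) auto
    moreover have "Suc u + 2 * q - Suc w = 1" using w by linarith
    ultimately show False using q2 by simp
  qed
  with dvd show ?thesis by blast
qed

lemma progression_length_le:
  assumes q: "prime q" and d: "1 \<le> d" "d < q ^ n"
    and ap: "\<And>j. j < k \<Longrightarrow> thue_morse q (c + j * d) = thue_morse q c"
  shows "k \<le> (if q dvd n then q ^ n + 2 * q else q ^ n)"
  using d ap
proof (induction n arbitrary: c d)
  case 0
  then show ?case by simp
next
  case (Suc n)
  have q2: "2 \<le> q" using q by (rule prime_ge_2_nat)
  show ?case
  proof (cases "q dvd d")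
    case True
    then obtain d' where d': "d = q * d'" by blast
    define c' r where "c' = c div q" and "r = c mod q"
    have c: "c = c' * q + r" and r: "r < q" using q2 by (auto simp: c'_def r_def)
    have "digit_sum q (c + j * d) = digit_sum q (c' + j * d') + r" for j
    proof -
      have "c + j * d = (c' + j * d') * q + r" by (simp add: c d' algebra_simps)
      then show ?thesis using digit_sum_mult_add[OF r q2] by simp
    qed
    from this[of 0] this have "thue_morse q (c' + j * d') = thue_morse q c'" if "j < k" for j
      using Suc.prems(3)[OF that] unfolding thue_morse_eq_iff by simp
    moreover have "1 \<le> d'" "d' < q ^ n"
      using Suc.prems(1,2) by (auto simp: d' Suc_le_eq)
    ultimately have IH: "k \<le> (if q dvd n then q ^ n + 2 * q else q ^ n)"
      using Suc.IH by blast
    have le: "2 * q ^ n \<le> q ^ Suc n" using q2 by simp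
    have "k \<le> q ^ Suc n"
    proof (cases "q dvd n")
      case True
      \<comment> \<open>\<open>q\<close> divides 0, but the bound \<open>1 + 2 * q\<close> would be
        too large there; no \<open>d'\<close> is available for \<open>n = 0\<close>.\<close>
      have "n \<noteq> 0"
        using \<open>1 \<le> d'\<close> \<open>d' < q ^ n\<close> by (cases n) auto
      with True q2 have "2 \<le> n" by (auto dest: dvd_imp_le)
      then have "q ^ 2 \<le> q ^ n" using q2 by (intro power_increasing) auto
      moreover have "2 * q \<le> q ^ 2" using q2 by (simp add: power2_eq_square)
      ultimately have "2 * q \<le> q ^ n" by linarith
      then have "q ^ n + 2 * q \<le> q ^ Suc n" using le by linarith
      then show ?thesis using IH True by simp
    next
      case False
      then have "k \<le> q ^ n" using IH by simp
      then show ?thesis using le by linarith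
    qed
    then show ?thesis by simp
  next
    case False
    show ?thesis
    proof (cases "q ^ Suc n < k")
      case True
      have "d = q ^ Suc n - 1"
        using progression_difference[OF q _ Suc.prems(2) False True Suc.prems(3)] by simp
      then have "q dvd Suc n \<and> k \<le> q ^ Suc n + 2 * q"
        using progression_maximal_difference[where c = c, OF q _ True] Suc.prems(3) by simp
      then show ?thesis by simp
    qed auto
  qed
qed

section \<open>Lower bound\<close>

text \<open>For \<open>k < q^n\<close> the digits of the low part \<open>q^n - 1 - k\<close> are complementary to those of \<open>k\<close>,
  so the sum of the two digit sums does not depend on \<open>k\<close>.\<close>

lemma digit_sum_middle:
  assumes q2: "2 \<le> q" and "k < q ^ n"
  shows "digit_sum q (((b * q ^ n) + k) * q ^ n + (q ^ n - 1 - k)) = digit_sum q b + n * (q - 1)"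
  using digit_sum_complement[OF assms]
    digit_sum_power_mult_add[OF q2, of "q ^ n - 1 - k" n "b * q ^ n + k"]
    digit_sum_power_mult_add[OF q2, of k n b] assms by simp

text \<open>The terms are \<open>(j + 1) * (q ^ n - 1)\<close>, whose high part \<open>j\<close> and
  low part \<open>q ^ n - 1 - j\<close> are complementary.\<close>

lemma progression_power:
  assumes q2: "2 \<le> q" and j: "j < q ^ n"
  shows "thue_morse q ((q ^ n - 1) + j * (q ^ n - 1)) = thue_morse q (q ^ n - 1)"
proof -
  obtain m where m: "q ^ n = Suc (j + m)" using j less_iff_Suc_add by auto
  have "(q ^ n - 1) + j * (q ^ n - 1) = j * q ^ n + (q ^ n - 1 - j)"
    by (simp add: m)
  then show ?thesis
    using digit_sum_middle[OF q2 j, of 0] digit_sum_power_minus_Suc_0[OF q2, of n]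
    by (simp add: thue_morse_def)
qed

text \<open>The start \<open>c\<close> lies \<open>q\<close> steps before
  \<open>q ^ q * q ^ n * q ^ n + (q ^ n - 1)\<close>, where the complementary run begins. The
  leading \<open>q ^ q\<close> contributes 1 to the digit sum, and the exponent \<open>q\<close>
  makes the digit sum of \<open>q ^ q - 1\<close> a multiple of \<open>q\<close>.\<close>

lemma progression_power_dvd:
  assumes q2: "2 \<le> q" and n: "1 \<le> n" "q dvd n" and j: "j < q ^ n + 2 * q"
  defines "c \<equiv> (q ^ q * q ^ n + 1 - q) * q ^ n + (q - 1)"
  shows "thue_morse q (c + j * (q ^ n - 1)) = 1"
proof -
  define Q where "Q = q ^ n"
  define B where "B = q ^ q * Q"
  have qn: "q \<le> n" using n by (auto dest: dvd_imp_le)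
  have "q ^ 1 \<le> Q" unfolding Q_def using n q2 by (intro power_increasing) auto
  then have qQ: "q \<le> Q" by simp
  have "q ^ 1 \<le> q ^ q" using q2 by (intro power_increasing) auto
  then have qq: "q \<le> q ^ q" by simp
  have "1 * Q \<le> B" unfolding B_def using qq q2 by (intro mult_right_mono) auto
  then have QB: "Q \<le> B" by simp
  have c: "c = (B + 1 - q) * Q + (q - 1)" by (simp add: c_def B_def Q_def)
  have split: "digit_sum q (u * Q + v) = digit_sum q u + digit_sum q v" if "v < Q" for u v
    using digit_sum_power_mult_add[OF q2, of v n u] that by (simp add: Q_def)
  have dvdnq: "q dvd n * (q - 1)" using n by simp
  have one: "digit_sum q 1 = 1" using q2 by (simp add: digit_sum_less)
  have s_B: "digit_sum q (q ^ q) = 1"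
    using digit_sum_power_mult_add[OF q2, of 0 q 1] q2 one by simp
  have one_mod: "(x + 1) mod q = 1" if "q dvd x" for x
  proof -
    from that obtain k where "x = q * k" ..
    then have "(x + 1) mod q = 1 mod q" by (simp only: mod_mult_self4)
    then show ?thesis using q2 by simp
  qed
  consider (left) "j < q" | (middle) "q \<le> j" "j < q + Q" | (right) "q + Q \<le> j" "j < Q + 2 * q"
    using j unfolding Q_def by linarith
  then have "digit_sum q (c + j * (Q - 1)) mod q = 1"
  proof cases
    case left
    define i where "i = q - 1 - j"
    have i: "q = Suc (i + j)" using left by (simp add: i_def)
    obtain R where R: "Q = Suc R" using qQ q2 by (cases Q) auto
    obtain b where b: "B = b + i + j" using qQ QB i by (metis add.assoc le_iff_add le_trans Suc_leD add.commute)
    have x: "c + j * (Q - 1) = (B - i) * Q + i"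
      unfolding c by (simp add: i R b algebra_simps)
    have iQ: "i < Q" using i qQ by simp
    have iq: "i < q" using i by simp
    have "digit_sum q (c + j * (Q - 1)) = digit_sum q (B - i) + i"
      unfolding x split[OF iQ] using iq by (simp add: digit_sum_less)
    also have "\<dots> mod q = 1"
    proof (cases "i = 0")
      case True
      then show ?thesis
        using split[of 0 "q ^ q"] s_B q2 qQ by (simp add: B_def)
    next
      case False
      \<comment> \<open>The subtraction borrows from \<open>q ^ q\<close>; this is where the digit
        sum of \<open>q ^ q - 1\<close> enters.\<close>
      have Bi: "B - i = (q ^ q - 1) * Q + (Q - 1 - (i - 1))"
      proof -
        obtain z where z: "q ^ q = Suc z" using qq q2 by (cases "q ^ q") auto
        show ?thesis using False iQ by (simp add: B_def z)
      qed
      have "digit_sum q (Q - 1 - (i - 1)) + (i - 1) = n * (q - 1)"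
        using digit_sum_complement[OF q2, of "i - 1" n] iQ iq by (simp add: digit_sum_less Q_def)
      then have "digit_sum q (B - i) + i = (q * (q - 1) + n * (q - 1)) + 1"
        unfolding Bi using split[of "Q - 1 - (i - 1)" "q ^ q - 1"] iQ False
          digit_sum_power_minus_Suc_0[OF q2, of q] by linarith
      then show ?thesis using one_mod dvdnq by (metis dvd_add dvd_triv_left)
    qed
    finally show ?thesis .
  next
    case middle
    define k where "k = j - q"
    have k: "j = q + k" "k < Q" using middle by (auto simp: k_def)
    obtain m where m: "Q = Suc (k + m)" using k(2) less_iff_Suc_add by auto
    obtain b where b: "B = b + q" using qQ QB by (metis add.commute le_iff_add le_trans)
    obtain p where p: "q = Suc p" using q2 by (cases q) auto
    have x: "c + j * (Q - 1) = (B + k) * Q + (Q - 1 - k)"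
      unfolding c by (simp add: k(1) b m p algebra_simps)
    have "digit_sum q (c + j * (Q - 1)) = n * (q - 1) + 1"
      unfolding x using digit_sum_middle[OF q2, of k n "q ^ q"] k(2) s_B
      by (simp add: B_def Q_def)
    then show ?thesis using one_mod[OF dvdnq] by simp
  next
    case right
    define i where "i = j - (q + Q)"
    have i: "j = q + Q + i" "i < q" using right by (auto simp: i_def)
    obtain m where m: "Q = Suc (i + m)" using i(2) qQ less_iff_Suc_add by (metis order_less_le_trans)
    obtain b where b: "B = b + q" using qQ QB by (metis add.commute le_iff_add le_trans)
    obtain p where p: "q = Suc p" using q2 by (cases q) auto
    \<comment> \<open>The \<open>- 1\<close> arises because the step from low part 0, at the end of
      the middle run, keeps the high part.\<close>
    have x: "c + j * (Q - 1) = (B + Q + i - 1) * Q + (Q - 1 - i)"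
      unfolding c by (simp add: i(1) b m p algebra_simps)
    have compl: "digit_sum q (Q - 1 - i) + i = n * (q - 1)"
      using digit_sum_complement[OF q2, of i n] i(2) qQ by (simp add: digit_sum_less Q_def)
    have y: "digit_sum q (c + j * (Q - 1)) = digit_sum q (B + Q + i - 1) + digit_sum q (Q - 1 - i)"
      unfolding x using split m by simp
    show ?thesis
    proof (cases "i = 0")
      case True
      have B': "B + Q + i - 1 = q ^ q * Q + (Q - 1)" using True m unfolding B_def by linarith
      have "Q - 1 < Q" using m by simp
      then have "digit_sum q (B + Q + i - 1) = 1 + n * (q - 1)"
        unfolding B' split[OF \<open>Q - 1 < Q\<close>] s_B
        using digit_sum_power_minus_Suc_0[OF q2, of n] by (simp add: Q_def)
      then have "digit_sum q (c + j * (Q - 1)) = (n * (q - 1) + n * (q - 1)) + 1"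
        using y compl True by simp
      then show ?thesis using one_mod dvdnq by (metis dvd_add)
    next
      case False
      have "B + Q + i - 1 = (q ^ q + 1) * Q + (i - 1)" using False by (simp add: B_def)
      moreover have "digit_sum q (1 * q ^ q + 1) = 2"
        using digit_sum_power_mult_add[OF q2, of 1 q 1] one qq q2 by simp
      ultimately have "digit_sum q (B + Q + i - 1) = 2 + (i - 1)"
        using split[of "i - 1" "q ^ q + 1"] i(2) qQ by (simp add: digit_sum_less)
      then have "digit_sum q (c + j * (Q - 1)) = n * (q - 1) + 1"
        using y compl False by simp
      then show ?thesis using one_mod[OF dvdnq] by simp
    qed
  qed
  then show ?thesis by (simp add: thue_morse_def Q_def)
qed

section \<open>The maximum\<close>

lemma ap_length_geI:
  assumes "1 \<le> k" "\<And>j. j < k \<Longrightarrow> w (c + j * d) = w c"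
  shows "enat k \<le> ap_length w d"
proof -
  have "enat k \<le> ap_length_at w c d"
    unfolding ap_length_at_def using assms by (intro Sup_upper) blast
  also have "\<dots> \<le> ap_length w d"
    unfolding ap_length_def by (intro SUP_upper) auto
  finally show ?thesis .
qed

text \<open>For finite \<open>M\<close> this also excludes infinite constant progressions, since
  their finite prefixes have unbounded length.\<close>

lemma ap_length_leI:
  assumes "\<And>c k. (\<And>j. j < k \<Longrightarrow> w (c + j * d) = w c) \<Longrightarrow> enat k \<le> M"
  shows "ap_length w d \<le> M"
  unfolding ap_length_def ap_length_at_def
  using assms by (intro SUP_least Sup_least) blast

theorem theorem1:
  fixes q n :: nat
  assumes "prime q" and "n \<ge> 1"
  shows "Max (ap_length (thue_morse q) ` {d. 1 \<le> d \<and> d < q ^ n})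
           = (if n mod q = 0 then enat (q ^ n + 2 * q) else enat (q ^ n))
       \<and> ap_length (thue_morse q) (q ^ n - 1)
           = Max (ap_length (thue_morse q) ` {d. 1 \<le> d \<and> d < q ^ n})"
proof -
  define M where "M = (if n mod q = 0 then enat (q ^ n + 2 * q) else enat (q ^ n))"
  have q2: "2 \<le> q" using assms(1) by (rule prime_ge_2_nat)
  have "q ^ 1 \<le> q ^ n" using assms q2 by (intro power_increasing) auto
  then have qn: "q \<le> q ^ n" by simp
  have upper: "ap_length (thue_morse q) d \<le> M" if "1 \<le> d" "d < q ^ n" for d
  proof (rule ap_length_leI)
    fix c k
    assume "\<And>j. j < k \<Longrightarrow> thue_morse q (c + j * d) = thue_morse q c"
    from progression_length_le[where c = c and k = k, OF assms(1) that this] show "enat k \<le> M"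
      by (simp add: M_def mod_eq_0_iff_dvd split: if_splits)
  qed
  have lower: "M \<le> ap_length (thue_morse q) (q ^ n - 1)"
  proof (cases "n mod q = 0")
    case True
    then have *: "q dvd n" by auto
    let ?c = "(q ^ q * q ^ n + 1 - q) * q ^ n + (q - 1)"
    note one = progression_power_dvd[OF q2 assms(2) *]
    have "enat (q ^ n + 2 * q) \<le> ap_length (thue_morse q) (q ^ n - 1)"
    proof (rule ap_length_geI[where c = ?c])
      show "thue_morse q (?c + j * (q ^ n - 1)) = thue_morse q ?c" if "j < q ^ n + 2 * q" for j
        using one[OF that] one[of 0] q2 by simp
    qed (use q2 in simp)
    with True show ?thesis by (simp add: M_def)
  next
    case False
    have "enat (q ^ n) \<le> ap_length (thue_morse q) (q ^ n - 1)"
      using progression_power[OF q2] q2 by (intro ap_length_geI[where c = "q ^ n - 1"]) auto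
    with False show ?thesis by (simp add: M_def)
  qed
  have mem: "q ^ n - 1 \<in> {d. 1 \<le> d \<and> d < q ^ n}" using qn q2 by auto
  have eq: "ap_length (thue_morse q) (q ^ n - 1) = M"
    using upper[of "q ^ n - 1"] lower mem by auto
  moreover have "Max (ap_length (thue_morse q) ` {d. 1 \<le> d \<and> d < q ^ n}) = M"
  proof (rule Max_eqI)
    show "M \<in> ap_length (thue_morse q) ` {d. 1 \<le> d \<and> d < q ^ n}"
      using mem eq by blast
  qed (use upper in auto)
  ultimately show ?thesis unfolding M_def by simp
qed

end
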